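(* Let $X$ be a locally compact metric space, let $\Omega\subset X$ be open, let $F\colon\Omega\times[a,b]\times[a,b]\to X$ satisfy $F(x,\tau,\tau)=x$ for all $x\in\Omega$, $\tau\in[a,b]$, and let $\tilde{x}\in\Omega$ be such that the limit $F(\tilde{x},a,a+):=\lim_{t\to a_+}F(\tilde{x},a,t)$ belongs to $\Omega$. Assume the following: 1. For every $\tau,t\in[a,b]$ the function $x\mapsto F(x,\tau,t)$ is continuous. 2. There exist an increasing function $h\colon[a,b]\to\mathbb{R}$ and a modulus function $\zeta$ such that for every $x\in\Omega$ and every $\tau,t,s\in[a,b]$, $$|F(x,\tau,t)-F(x,\tau,s)|\leq\zeta(|h(t)-h(s)|).$$ 3. There exists a neighbourhood $\mathcal{U}\subset\Omega$ of $F(\tilde{x},a,a+)$ such that for every $\tau\in(a,b]$ there exists $\mu_\tau>0$ such that for every $x\in\mathcal{U}$ and $t\in(\tau-\mu_\tau,\tau)$ there exists $y\in\Omega$ with $F(y,\tau,t)=x$. 4. There exist an increasing function $\xi\colon[a,b]\to\mathbb{R}$ and a modulus function $\omega\colon\mathbb{R}^+_0\to\mathbb{R}^+_0$ such that for all $\tau,\sigma,t,s\in[a,b]$ and $x,y\in\Omega$, $$|F(x,\tau,t)-F(y,\sigma,t)|\leq|F(x,\tau,s)-F(y,\sigma,s)|+\omega(|x-y|+|\tau-\sigma|)\,|\xi(t)-\xi(s)|.$$ Then there exist $\Delta>0$ and a solution $u\colon[a,a+\Delta]\to X$ of $\dot{x}=\mathrm{D}_t\,F(x,\tau,t)$ on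 $[a,a+\Delta]$ with $u(a)=\tilde{x}$.
   Context: $|x-y|$ denotes the distance between points $x,y$ of the metric space $X$ (and absolute value for reals). $\mathbb{R}^+$ is the set of positive reals and $\mathbb{R}^+_0$ the set of nonnegative reals. "Increasing" means strictly increasing. In condition 3, $t$ ranges over points of $[a,b]$, where $F$ is defined. In the conclusion, $[a,a+\Delta]\subset[a,b]$. A modulus function is a function $\omega\colon\mathbb{R}^+_0\to\mathbb{R}^+_0$ that is continuous, nondecreasing, with $\omega(0)=0$ and $\omega(\nu)>0$ for $\nu>0$. Partitions: a partition of $[\alpha,\beta]$ is a collection $\{[t_{i-1},t_i],\tau_i\}_{i=1}^k$ of consecutive closed intervals with tags such that $t_0=\alpha$, $t_k=\beta$, $\tau_i\in[t_{i-1},t_i]$. For $\delta\colon[\alpha,\beta]\to\mathbb{R}^+$ it is $\delta$-fine if $[t_{i-1},t_i]\subset(\tau_i-\delta(\tau_i),\tau_i+\delta(\tau_i))$ for every $i$. Solutions: let $I\subset\mathbb{R}$ be an interval and let $F$ (with values in $X$, satisfying $F(x,\tau,\tau)=x$) be defined on $\Omega\times I\times I$ (or restricted to it). A function $u\colon I\to X$ is a solution of $\dot{x}=\mathrm{D}_t\,F(x,\tau,t)$ on $I$ if $u(\tau)\in\Omega$ for all $\tau\in I$ and the constant zero is an indefinite strong Henstock-Kurzweil integral of $U(\tau,t)=|u(t)-F(u(\tau),\tau,t)|$ on $I$, i.e. for every $\varepsilon>0$ and every $[\alpha,\beta]\subset I$ there exists $\delta\colon[\alpha,\beta]\to\mathbb{R}^+$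 such that every $\delta$-fine partition $\{[t_{i-1},t_i],\tau_i\}_{i=1}^k$ of $[\alpha,\beta]$ satisfies $$\sum_{i=1}^k\Big|\,|u(t_i)-F(u(\tau_i),\tau_i,t_i)|-|u(t_{i-1})-F(u(\tau_i),\tau_i,t_{i-1})|\,\Big|<\varepsilon.$$ *)

theory Defs
  imports "HOL-Analysis.Analysis"
begin

text \<open>Functions on \<open>[0, \<infinity>)\<close>, \<open>[a, b]\<close> or \<open>\<Omega> \<times> [a, b] \<times> [a, b]\<close> are represented by total functions;
  every condition below constrains and uses them only on their mathematical domain.\<close>

definition modulus_function :: "(real \<Rightarrow> real) \<Rightarrow> bool" where
  "modulus_function \<omega> \<longleftrightarrow>
     \<omega> \<in> {0..} \<rightarrow> {0..} \<and> continuous_on {0..} \<omega> \<and> mono_on {0..} \<omega> \<and>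
     \<omega> 0 = 0 \<and> (\<forall>\<nu>>0. \<omega> \<nu> > 0)"

text \<open>The intervals are \<open>[t (i-1), t i]\<close> with tags \<open>\<tau> i\<close> for \<open>1 \<le> i \<le> k\<close>. Degenerate intervals
  are allowed; they contribute zero to the sums below.\<close>

definition tagged_partition ::
  "real \<Rightarrow> real \<Rightarrow> nat \<Rightarrow> (nat \<Rightarrow> real) \<Rightarrow> (nat \<Rightarrow> real) \<Rightarrow> bool" where
  "tagged_partition \<alpha> \<beta> k t \<tau> \<longleftrightarrow>
     t 0 = \<alpha> \<and> t k = \<beta> \<and> (\<forall>i\<in>{1..k}. t (i - 1) \<le> t i \<and> \<tau> i \<in> {t (i - 1)..t i})"

definition delta_fine ::
  "(real \<Rightarrow> real) \<Rightarrow> nat \<Rightarrow> (nat \<Rightarrow> real) \<Rightarrow> (nat \<Rightarrow> real) \<Rightarrow> bool" where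
  "delta_fine \<delta> k t \<tau> \<longleftrightarrow>
     (\<forall>i\<in>{1..k}. {t (i - 1)..t i} \<subseteq> {\<tau> i - \<delta> (\<tau> i)<..<\<tau> i + \<delta> (\<tau> i)})"

text \<open>\<open>V\<close> is an indefinite strong Henstock-Kurzweil integral on \<open>I\<close> of the function
  \<open>U (\<tau>, t)\<close>, whose first argument is the tag.\<close>

definition indefinite_strong_HK_integral ::
  "real set \<Rightarrow> (real \<Rightarrow> real \<Rightarrow> real) \<Rightarrow> (real \<Rightarrow> real) \<Rightarrow> bool" where
  "indefinite_strong_HK_integral I U V \<longleftrightarrow>
     (\<forall>\<epsilon>>0. \<forall>\<alpha> \<beta>. \<alpha> \<le> \<beta> \<and> {\<alpha>..\<beta>} \<subseteq> I \<longrightarrow>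
        (\<exists>\<delta>. (\<forall>x\<in>{\<alpha>..\<beta>}. \<delta> x > 0) \<and>
           (\<forall>k t \<tau>. tagged_partition \<alpha> \<beta> k t \<tau> \<and> delta_fine \<delta> k t \<tau> \<longrightarrow>
              (\<Sum>i=1..k. \<bar>(U (\<tau> i) (t i) - U (\<tau> i) (t (i - 1))) - (V (t i) - V (t (i - 1)))\<bar>)
                < \<epsilon>)))"

text \<open>Solutions of \<open>x' = D\<^sub>t F(x, \<tau>, t)\<close> on an interval \<open>I\<close>.\<close>

definition is_solution ::
  "'a::metric_space set \<Rightarrow> ('a \<Rightarrow> real \<Rightarrow> real \<Rightarrow> 'a) \<Rightarrow> real set \<Rightarrow> (real \<Rightarrow> 'a) \<Rightarrow> bool" where
  "is_solution \<Omega> F I u \<longleftrightarrow>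
     (\<forall>\<tau>\<in>I. u \<tau> \<in> \<Omega>) \<and>
     indefinite_strong_HK_integral I (\<lambda>\<tau> t. dist (u t) (F (u \<tau>) \<tau> t)) (\<lambda>_. 0)"

end

theory Submission
  imports Defs
begin

text \<open>With \<open>g = h + \<xi>\<close> in place of both \<open>h\<close> and \<open>\<xi>\<close>, it suffices to find \<open>u\<close> such that for each \<open>\<tau>\<close> and
  \<open>\<eta> > 0\<close> one has \<open>dist (u t) (F (u \<tau>) \<tau> t) \<le> \<eta> \<bar>g t - g \<tau>\<bar>\<close> for \<open>t\<close> near \<open>\<tau>\<close>, since these bounds telescope over a
  fine partition. For a finite set of times, move from one time \<open>s\<close> to the next time \<open>s'\<close> with tag \<open>s\<close>
  until just before \<open>s'\<close> and from there with tag \<open>s'\<close>, which is possible by the solvability condition.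
  Comparing such a chain with \<open>F x0 a\<close> keeps it in a compact ball around \<open>L\<close>; comparing it with
  \<open>F (u \<tau>) \<tau>\<close> bounds \<open>dist (u t) (F (u \<tau>) \<tau> t)\<close> by an explicit \<open>err \<tau> t\<close> that is independent of the
  finite set and \<open>o(\<bar>g t - g \<tau>\<bar>)\<close> as \<open>t\<close> tends to \<open>\<tau>\<close>. These are closed conditions on pairs of values, so
  Tychonoff's theorem yields one \<open>u\<close> that satisfies all of them.\<close>

section \<open>Modulus functions and a compactness principle\<close>

lemma modulus_functionD:
  assumes "modulus_function \<omega>"
  shows modulus_nonneg: "0 \<le> s \<Longrightarrow> 0 \<le> \<omega> s"
    and modulus_mono: "0 \<le> s \<Longrightarrow> s \<le> t \<Longrightarrow> \<omega> s \<le> \<omega> t"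
    and modulus_zero: "\<omega> 0 = 0"
    and modulus_cont: "continuous_on {0..} \<omega>"
  using assms by (auto simp: modulus_function_def mono_on_def)

text \<open>Tychonoff's theorem with the finite intersection property. The choice functions form a
  compact product; a condition on the coordinates \<open>i\<close> and \<open>j\<close> is closed
  there, being the preimage of \<open>P i j\<close> under a continuous map; and finitely many such
  conditions involve only finitely many indices, so \<open>fin\<close> shows that they are
  compatible.\<close>

lemma compact_pairwise_selection:
  fixes K :: "'i \<Rightarrow> 'a::metric_space set" and P :: "'i \<Rightarrow> 'i \<Rightarrow> ('a \<times> 'a) set"
  assumes K: "\<And>i. i \<in> I \<Longrightarrow> compact (K i)" "\<And>i. i \<in> I \<Longrightarrow> K i \<noteq> {}"
    and P: "\<And>i j. i \<in> I \<Longrightarrow> j \<in> I \<Longrightarrow> closed (P i j)"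
    and fin: "\<And>T. finite T \<Longrightarrow> T \<subseteq> I \<Longrightarrow>
      \<exists>v. (\<forall>i\<in>T. v i \<in> K i) \<and> (\<forall>i\<in>T. \<forall>j\<in>T. (v i, v j) \<in> P i j)"
  shows "\<exists>u. (\<forall>i\<in>I. u i \<in> K i) \<and> (\<forall>i\<in>I. \<forall>j\<in>I. (u i, u j) \<in> P i j)"
proof -
  define X where "X = product_topology (\<lambda>_. euclidean :: 'a topology) I"
  define C where "C = (\<lambda>(i, j). {f \<in> topspace X. (f i, f j) \<in> P i j})"
  have comp: "compactin X (PiE I K)"
    unfolding X_def using K by (auto simp: compactin_PiE)
  have closed: "closedin X (C (i, j))" if ij: "i \<in> I" "j \<in> I" for i j
  proof -
    have "continuous_map X (prod_topology euclidean euclidean) (\<lambda>f. (f i, f j))"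
      unfolding X_def using ij by (intro continuous_map_pairedI continuous_map_product_projection)
    then have "continuous_map X euclidean (\<lambda>f. (f i, f j))"
      by (simp add: euclidean_product_topology)
    from closedin_continuous_map_preimage[OF this, of "P i j"] show ?thesis
      using P ij by (simp add: C_def)
  qed
  have "PiE I K \<inter> \<Inter> \<F> \<noteq> {}" if \<F>: "finite \<F>" "\<F> \<subseteq> C ` (I \<times> I)" for \<F>
  proof -
    obtain Q where Q: "finite Q" "Q \<subseteq> I \<times> I" "\<F> = C ` Q"
      using finite_subset_image[OF \<F>] by auto
    define T where "T = fst ` Q \<union> snd ` Q"
    have "finite T" "T \<subseteq> I"
      using Q by (auto simp: T_def)
    then obtain v where v: "\<forall>i\<in>T. v i \<in> K i" "\<forall>i\<in>T. \<forall>j\<in>T. (v i, v j) \<in> P i j"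
      using fin[of T] by blast
    \<comment> \<open>Outside \<open>T\<close> any point of \<open>K i\<close> will do, as the
      conditions in question only see indices in \<open>T\<close>; the restriction to
      \<open>I\<close> is what membership in \<open>PiE\<close> demands.\<close>
    define w where "w = (\<lambda>i\<in>I. if i \<in> T then v i else (SOME z. z \<in> K i))"
    have "w \<in> PiE I K"
      unfolding w_def
    proof (rule restrict_PiE_iff[THEN iffD2], rule ballI)
      fix i assume "i \<in> I"
      then show "(if i \<in> T then v i else (SOME z. z \<in> K i)) \<in> K i"
        using v(1) K(2) by (simp add: some_in_eq)
    qed
    moreover have "w \<in> C ij" if "ij \<in> Q" for ij
    proof -
      obtain i j where ij: "ij = (i, j)"
        by (cases ij)
      have "i \<in> T" "j \<in> T"
        using that ij by (force simp: T_def)+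
      then show ?thesis
        using v(2) \<open>T \<subseteq> I\<close> by (simp add: ij C_def w_def X_def subset_iff)
    qed
    ultimately show ?thesis
      using Q by auto
  qed
  moreover have "\<forall>D\<in>C ` (I \<times> I). closedin X D"
    using closed by auto
  ultimately have "PiE I K \<inter> \<Inter> (C ` (I \<times> I)) \<noteq> {}"
    using comp[unfolded compactin_fip, THEN conjunct2, rule_format, of "C ` (I \<times> I)"] by blast
  then obtain u where u: "u \<in> PiE I K" "u \<in> \<Inter> (C ` (I \<times> I))"
    by blast
  have "u i \<in> K i" if "i \<in> I" for i
    using PiE_mem[OF u(1) that] .
  moreover have "(u i, u j) \<in> P i j" if "i \<in> I" "j \<in> I" for i j
  proof -
    have "u \<in> C (i, j)"
      using u(2) that by blast
    then show ?thesis
      by (simp add: C_def)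
  qed
  ultimately show ?thesis
    by blast
qed

section \<open>Local error bounds yield solutions\<close>

text \<open>In a fine partition both endpoints are close to the tag, so the two errors are at most
  \<open>\<eta>\<close> times the increments of \<open>g\<close> on either side of the tag. As
  \<open>g\<close> is monotone, these add up to \<open>\<eta> * (g (t i) - g (t (i - 1)))\<close>,
  which telescopes in the sum to \<open>\<eta> * (g \<beta> - g \<alpha>)\<close>.\<close>

lemma is_solutionI_local:
  fixes F :: "'a::metric_space \<Rightarrow> real \<Rightarrow> real \<Rightarrow> 'a"
  assumes g: "mono_on I g"
    and u: "\<And>\<tau>. \<tau> \<in> I \<Longrightarrow> u \<tau> \<in> \<Omega>"
    and loc: "\<And>\<tau> \<eta>. \<tau> \<in> I \<Longrightarrow> \<eta> > 0 \<Longrightarrow>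
      \<exists>\<delta>>0. \<forall>t\<in>I. \<bar>t - \<tau>\<bar> < \<delta> \<longrightarrow> dist (u t) (F (u \<tau>) \<tau> t) \<le> \<eta> * \<bar>g t - g \<tau>\<bar>"
  shows "is_solution \<Omega> F I u"
  unfolding is_solution_def indefinite_strong_HK_integral_def
proof (intro conjI ballI allI impI u; (assumption)?)
  fix \<epsilon> \<alpha> \<beta> :: real
  assume \<epsilon>: "\<epsilon> > 0" and "\<alpha> \<le> \<beta> \<and> {\<alpha>..\<beta>} \<subseteq> I"
  then have \<alpha>\<beta>: "\<alpha> \<le> \<beta>" "{\<alpha>..\<beta>} \<subseteq> I"
    by auto
  have g\<alpha>\<beta>: "g \<alpha> \<le> g \<beta>"
    using \<alpha>\<beta> by (intro mono_onD[OF g]) (auto simp: subset_iff)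
  \<comment> \<open>The summand 1 keeps the denominator positive when
    \<open>g \<alpha> = g \<beta>\<close> and makes the final inequality strict.\<close>
  define \<eta> where "\<eta> = \<epsilon> / (g \<beta> - g \<alpha> + 1)"
  have \<eta>: "\<eta> > 0" "\<eta> * (g \<beta> - g \<alpha>) < \<epsilon>"
    using \<epsilon> g\<alpha>\<beta> by (auto simp: \<eta>_def field_simps)
  obtain \<delta> where \<delta>: "\<And>\<tau>. \<tau> \<in> I \<Longrightarrow> \<delta> \<tau> > 0"
    "\<And>\<tau> t. \<tau> \<in> I \<Longrightarrow> t \<in> I \<Longrightarrow> \<bar>t - \<tau>\<bar> < \<delta> \<tau> \<Longrightarrow>
      dist (u t) (F (u \<tau>) \<tau> t) \<le> \<eta> * \<bar>g t - g \<tau>\<bar>"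
    using loc[OF _ \<eta>(1)] by metis
  let ?d = "\<lambda>\<tau> t. dist (u t) (F (u \<tau>) \<tau> t)"
  have "(\<Sum>i = 1..k. \<bar>?d (\<tau> i) (t i) - ?d (\<tau> i) (t (i - 1)) - (0 - 0)\<bar>) < \<epsilon>"
    if tp: "tagged_partition \<alpha> \<beta> k t \<tau>" and fine: "delta_fine \<delta> k t \<tau>" for k t \<tau>
  proof -
    have step: "t (i - 1) \<le> t i" "\<tau> i \<in> {t (i - 1)..t i}" if "i \<in> {1..k}" for i
      using tp that by (auto simp: tagged_partition_def)
    have ge: "\<alpha> \<le> t i" if "i \<le> k" for i
      using that
    proof (induction i)
      case (Suc i)
      with step[of "Suc i"] show ?case by simp
    qed (use tp in \<open>simp add: tagged_partition_def\<close>)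
    have le: "t i \<le> \<beta>" if "i \<le> k" for i
      using that
    proof (induction i rule: inc_induct)
      case (step i)
      with \<open>\<And>i. i \<in> {1..k} \<Longrightarrow> t (i - 1) \<le> t i\<close>[of "Suc i"] show ?case by simp
    qed (use tp in \<open>simp add: tagged_partition_def\<close>)
    have "\<bar>?d (\<tau> i) (t i) - ?d (\<tau> i) (t (i - 1)) - (0 - 0)\<bar> \<le> \<eta> * (g (t i) - g (t (i - 1)))"
      if i: "i \<in> {1..k}" for i
    proof -
      have ti: "t (i - 1) \<le> \<tau> i" "\<tau> i \<le> t i"
        using step[OF i] by auto
      have mem: "t (i - 1) \<in> I" "\<tau> i \<in> I" "t i \<in> I"
        using ti ge[of "i - 1"] le[of i] i by (intro subsetD[OF \<alpha>\<beta>(2)]; force)+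
      have "{t (i - 1)..t i} \<subseteq> {\<tau> i - \<delta> (\<tau> i)<..<\<tau> i + \<delta> (\<tau> i)}"
        using fine i by (auto simp: delta_fine_def)
      then have "{t (i - 1), t i} \<subseteq> {\<tau> i - \<delta> (\<tau> i)<..<\<tau> i + \<delta> (\<tau> i)}"
        using ti by (elim subset_trans[rotated]) auto
      then have "\<bar>t (i - 1) - \<tau> i\<bar> < \<delta> (\<tau> i)" "\<bar>t i - \<tau> i\<bar> < \<delta> (\<tau> i)"
        by auto
      then have "?d (\<tau> i) (t i) \<le> \<eta> * \<bar>g (t i) - g (\<tau> i)\<bar>"
        "?d (\<tau> i) (t (i - 1)) \<le> \<eta> * \<bar>g (t (i - 1)) - g (\<tau> i)\<bar>"
        using \<delta>(2) mem by auto
      moreover have "g (t (i - 1)) \<le> g (\<tau> i)" "g (\<tau> i) \<le> g (t i)"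
        using g mem ti by (auto simp: mono_on_def)
      moreover have "\<bar>?d (\<tau> i) (t i) - ?d (\<tau> i) (t (i - 1)) - (0 - 0)\<bar>
          \<le> ?d (\<tau> i) (t i) + ?d (\<tau> i) (t (i - 1))"
        by (smt (verit) zero_le_dist)
      ultimately show ?thesis
        by (simp add: algebra_simps)
    qed
    then have "(\<Sum>i = 1..k. \<bar>?d (\<tau> i) (t i) - ?d (\<tau> i) (t (i - 1)) - (0 - 0)\<bar>)
        \<le> (\<Sum>i = 1..k. \<eta> * (g (t i) - g (t (i - 1))))"
      by (intro sum_mono)
    also have "\<dots> = \<eta> * (\<Sum>i = 1..k. g (t i) - g (t (i - 1)))"
      by (simp add: sum_distrib_left)
    also have "(\<Sum>i = 1..k. g (t i) - g (t (i - 1))) = g (t k) - g (t 0)"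
      by (induction k) auto
    also have "g (t k) - g (t 0) = g \<beta> - g \<alpha>"
      using tp by (simp add: tagged_partition_def)
    finally show ?thesis
      using \<eta> by simp
  qed
  then show "\<exists>\<delta>. (\<forall>x\<in>{\<alpha>..\<beta>}. 0 < \<delta> x) \<and>
     (\<forall>k t \<tau>. tagged_partition \<alpha> \<beta> k t \<tau> \<and> delta_fine \<delta> k t \<tau> \<longrightarrow>
       (\<Sum>i = 1..k. \<bar>?d (\<tau> i) (t i) - ?d (\<tau> i) (t (i - 1)) - (0 - 0)\<bar>) < \<epsilon>)"
    using \<delta>(1) \<alpha>\<beta> by (intro exI[of _ \<delta>]) auto
qed

section \<open>The equation with a single control function\<close>

text \<open>Here \<open>g\<close> controls both the variation of \<open>F\<close> and the comparison
  estimate. The solvability condition enters later, in \<open>chain_exists\<close> and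
  \<open>local_solution\<close>, for a ball and a shortened time interval.\<close>

locale gode =
  fixes \<Omega> :: "'a::metric_space set" and F :: "'a \<Rightarrow> real \<Rightarrow> real \<Rightarrow> 'a"
    and a b :: real and g \<zeta> \<omega> :: "real \<Rightarrow> real"
  assumes F_diag: "\<And>x \<tau>. x \<in> \<Omega> \<Longrightarrow> \<tau> \<in> {a..b} \<Longrightarrow> F x \<tau> \<tau> = x"
    and F_cont: "\<And>\<tau> t. \<tau> \<in> {a..b} \<Longrightarrow> t \<in> {a..b} \<Longrightarrow> continuous_on \<Omega> (\<lambda>x. F x \<tau> t)"
    and g_mono: "mono_on {a..b} g"
    and \<zeta>: "modulus_function \<zeta>" and \<omega>: "modulus_function \<omega>"
    and F_var: "\<And>x \<tau> t s. x \<in> \<Omega> \<Longrightarrow> \<tau> \<in> {a..b} \<Longrightarrow> t \<in> {a..b} \<Longrightarrow> s \<in> {a..b} \<Longrightarrow>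
      dist (F x \<tau> t) (F x \<tau> s) \<le> \<zeta> \<bar>g t - g s\<bar>"
    and F_comp: "\<And>\<tau> \<sigma> t s x y. \<tau> \<in> {a..b} \<Longrightarrow> \<sigma> \<in> {a..b} \<Longrightarrow> t \<in> {a..b} \<Longrightarrow> s \<in> {a..b} \<Longrightarrow>
      x \<in> \<Omega> \<Longrightarrow> y \<in> \<Omega> \<Longrightarrow>
      dist (F x \<tau> t) (F y \<sigma> t)
        \<le> dist (F x \<tau> s) (F y \<sigma> s) + \<omega> (dist x y + \<bar>\<tau> - \<sigma>\<bar>) * \<bar>g t - g s\<bar>"
begin

lemma g_le: "a \<le> s \<Longrightarrow> s \<le> t \<Longrightarrow> t \<le> b \<Longrightarrow> g s \<le> g t"
  using g_mono by (auto simp: mono_on_def)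

section \<open>Chains and comparison estimates along them\<close>

text \<open>\<open>x i\<close> is the state at time \<open>\<tau> i\<close>; the step from \<open>\<tau> i\<close> to \<open>\<tau> (i + 1)\<close> uses the tag \<open>\<tau> i\<close> up to the
  intermediate time \<open>p i\<close> and the tag \<open>\<tau> (i + 1)\<close> afterwards, so that it respects both one-sided
  jumps.\<close>

definition chain :: "nat \<Rightarrow> (nat \<Rightarrow> real) \<Rightarrow> (nat \<Rightarrow> real) \<Rightarrow> (nat \<Rightarrow> 'a) \<Rightarrow> bool" where
  "chain m \<tau> p x \<longleftrightarrow> (\<forall>i\<le>m. \<tau> i \<in> {a..b} \<and> x i \<in> \<Omega>) \<and>
     (\<forall>i<m. \<tau> i < p i \<and> p i < \<tau> (Suc i) \<and> F (x i) (\<tau> i) (p i) = F (x (Suc i)) (\<tau> (Suc i)) (p i))"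

lemma chain_mem:
  assumes "chain m \<tau> p x" "i \<le> m"
  shows "\<tau> i \<in> {a..b}" "x i \<in> \<Omega>"
  using assms by (auto simp: chain_def)

lemma chain_step:
  assumes "chain m \<tau> p x" "i < m"
  shows "\<tau> i < p i" "p i < \<tau> (Suc i)" "p i \<in> {a..b}"
    "F (x i) (\<tau> i) (p i) = F (x (Suc i)) (\<tau> (Suc i)) (p i)"
proof -
  show *: "\<tau> i < p i" "p i < \<tau> (Suc i)" "F (x i) (\<tau> i) (p i) = F (x (Suc i)) (\<tau> (Suc i)) (p i)"
    using assms by (auto simp: chain_def)
  show "p i \<in> {a..b}"
    using * chain_mem(1)[OF assms(1), of i] chain_mem(1)[OF assms(1), of "Suc i"] assms(2) by auto
qed

lemma chain_mono:
  assumes "chain m \<tau> p x" "i \<le> k" "k \<le> m"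
  shows "\<tau> i \<le> \<tau> k"
  using assms(2,3)
proof (induction k rule: dec_induct)
  case (step k)
  with chain_step[OF assms(1), of k] show ?case by simp
qed simp

text \<open>The comparison estimate \<open>F_comp\<close> can be used in both time directions, from
  \<open>s\<close> to \<open>t\<close> and back, which makes it two-sided.\<close>

lemma F_comp_abs:
  assumes "\<tau> \<in> {a..b}" "\<sigma> \<in> {a..b}" "s \<in> {a..b}" "t \<in> {a..b}" "s \<le> t" "x \<in> \<Omega>" "y \<in> \<Omega>"
    and "\<omega> (dist x y + \<bar>\<tau> - \<sigma>\<bar>) \<le> M"
  shows "\<bar>dist (F x \<tau> t) (F y \<sigma> t) - dist (F x \<tau> s) (F y \<sigma> s)\<bar> \<le> M * (g t - g s)"
proof -
  have "g s \<le> g t"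
    using g_le assms by auto
  then have "\<omega> (dist x y + \<bar>\<tau> - \<sigma>\<bar>) * \<bar>g t - g s\<bar> \<le> M * (g t - g s)"
    "\<bar>g s - g t\<bar> = \<bar>g t - g s\<bar>"
    using assms(8) by (auto intro: mult_right_mono)
  then have "dist (F x \<tau> t) (F y \<sigma> t) \<le> dist (F x \<tau> s) (F y \<sigma> s) + M * (g t - g s)"
    "dist (F x \<tau> s) (F y \<sigma> s) \<le> dist (F x \<tau> t) (F y \<sigma> t) + M * (g t - g s)"
    using F_comp[of \<tau> \<sigma> t s x y] F_comp[of \<tau> \<sigma> s t x y] assms(1-7) by simp_all
  then show ?thesis
    by linarith
qed

text \<open>Each step is compared with the curve \<open>F y \<sigma>\<close> in two pieces: up to
  \<open>p k\<close> with the tag \<open>\<tau> k\<close>, afterwards with the tag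
  \<open>\<tau> (Suc k)\<close>. Both pieces have the same value at \<open>p k\<close> and, by
  \<open>F_diag\<close>, the states as outer values, so the changes of distance add up along the
  chain.\<close>

lemma chain_telescope:
  assumes ch: "chain m \<tau> p x" and y: "y \<in> \<Omega>" "\<sigma> \<in> {a..b}" and "i \<le> k" "k \<le> m"
    and M: "\<And>j. i \<le> j \<Longrightarrow> j \<le> k \<Longrightarrow> \<omega> (dist (x j) y + \<bar>\<tau> j - \<sigma>\<bar>) \<le> M"
  shows "\<bar>dist (x k) (F y \<sigma> (\<tau> k)) - dist (x i) (F y \<sigma> (\<tau> i))\<bar> \<le> M * (g (\<tau> k) - g (\<tau> i))"
  using \<open>i \<le> k\<close> \<open>k \<le> m\<close> M
proof (induction k rule: dec_induct)
  case (step k)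
  note st = chain_step[OF ch, of k] and mem = chain_mem[OF ch, of k] chain_mem[OF ch, of "Suc k"]
  have "\<bar>dist (x k) (F y \<sigma> (\<tau> k)) - dist (x i) (F y \<sigma> (\<tau> i))\<bar> \<le> M * (g (\<tau> k) - g (\<tau> i))"
    using step by simp
  moreover have "\<bar>dist (F (x k) (\<tau> k) (p k)) (F y \<sigma> (p k)) - dist (F (x k) (\<tau> k) (\<tau> k)) (F y \<sigma> (\<tau> k))\<bar>
      \<le> M * (g (p k) - g (\<tau> k))"
    using step st mem y by (intro F_comp_abs) auto
  moreover have "\<bar>dist (F (x (Suc k)) (\<tau> (Suc k)) (\<tau> (Suc k))) (F y \<sigma> (\<tau> (Suc k)))
        - dist (F (x (Suc k)) (\<tau> (Suc k)) (p k)) (F y \<sigma> (p k))\<bar> \<le> M * (g (\<tau> (Suc k)) - g (p k))"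
    using step st mem y by (intro F_comp_abs) auto
  moreover have "F (x k) (\<tau> k) (\<tau> k) = x k" "F (x (Suc k)) (\<tau> (Suc k)) (\<tau> (Suc k)) = x (Suc k)"
    using F_diag mem step by auto
  ultimately show ?case
    using st(4) step by (simp add: algebra_simps)
qed simp

text \<open>Up to the time \<open>p i\<close> the chain coincides with the curve
  \<open>F (x i) (\<tau> i)\<close>, so the error accumulates only from \<open>p i\<close> on.
  Having \<open>g (p i)\<close> in place of \<open>g (\<tau> i)\<close> keeps a jump of
  \<open>g\<close> immediately after \<open>\<tau> i\<close> out of the bound.\<close>

lemma chain_forward:
  assumes ch: "chain m \<tau> p x" and "i < k" "k \<le> m"
    and M: "\<And>j. i < j \<Longrightarrow> j \<le> k \<Longrightarrow> \<omega> (dist (x j) (x i) + \<bar>\<tau> j - \<tau> i\<bar>) \<le> M"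
  shows "dist (x k) (F (x i) (\<tau> i) (\<tau> k)) \<le> M * (g (\<tau> k) - g (p i))"
proof -
  note st = chain_step[OF ch, of i] and mem = chain_mem[OF ch, of i] chain_mem[OF ch, of "Suc i"]
  have "\<bar>dist (F (x (Suc i)) (\<tau> (Suc i)) (\<tau> (Suc i))) (F (x i) (\<tau> i) (\<tau> (Suc i)))
        - dist (F (x (Suc i)) (\<tau> (Suc i)) (p i)) (F (x i) (\<tau> i) (p i))\<bar>
        \<le> M * (g (\<tau> (Suc i)) - g (p i))"
    using assms(2,3) st mem M[of "Suc i"] by (intro F_comp_abs) auto
  moreover have "F (x (Suc i)) (\<tau> (Suc i)) (\<tau> (Suc i)) = x (Suc i)"
    using F_diag mem assms by auto
  moreover have "\<bar>dist (x k) (F (x i) (\<tau> i) (\<tau> k)) - dist (x (Suc i)) (F (x i) (\<tau> i) (\<tau> (Suc i)))\<bar>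
      \<le> M * (g (\<tau> k) - g (\<tau> (Suc i)))"
    using assms mem by (intro chain_telescope[OF ch]) auto
  ultimately show ?thesis
    using st(4) assms by (simp add: algebra_simps)
qed

text \<open>The mirror image of \<open>chain_forward\<close>: from \<open>p l\<close> on the chain
  already follows the curve with tag \<open>\<tau> (Suc l)\<close>, so a jump of \<open>g\<close>
  immediately before this tag does not enter the bound.\<close>

lemma chain_backward:
  assumes ch: "chain m \<tau> p x" and "i \<le> l" "l < m"
    and M: "\<And>j. i \<le> j \<Longrightarrow> j \<le> l \<Longrightarrow> \<omega> (dist (x j) (x (Suc l)) + \<bar>\<tau> j - \<tau> (Suc l)\<bar>) \<le> M"
  shows "dist (x i) (F (x (Suc l)) (\<tau> (Suc l)) (\<tau> i)) \<le> M * (g (p l) - g (\<tau> i))"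
proof -
  note st = chain_step[OF ch, of l] and mem = chain_mem[OF ch, of l] chain_mem[OF ch, of "Suc l"]
  let ?y = "x (Suc l)" and ?\<sigma> = "\<tau> (Suc l)"
  have "\<bar>dist (F (x l) (\<tau> l) (p l)) (F ?y ?\<sigma> (p l)) - dist (F (x l) (\<tau> l) (\<tau> l)) (F ?y ?\<sigma> (\<tau> l))\<bar>
        \<le> M * (g (p l) - g (\<tau> l))"
    using assms(2,3) st mem M[of l] by (intro F_comp_abs) auto
  moreover have "F (x l) (\<tau> l) (\<tau> l) = x l"
    using F_diag mem assms by auto
  moreover have "\<bar>dist (x l) (F ?y ?\<sigma> (\<tau> l)) - dist (x i) (F ?y ?\<sigma> (\<tau> i))\<bar>
      \<le> M * (g (\<tau> l) - g (\<tau> i))"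
    using assms mem by (intro chain_telescope[OF ch]) auto
  ultimately show ?thesis
    using st(4) assms by (simp add: algebra_simps)
qed

section \<open>One-sided limits of \<open>g\<close> and the error function\<close>

text \<open>\<open>gplus b\<close> and \<open>gminus a\<close> are junk values (Inf and Sup of the empty set); the corresponding
  one-sided filters are trivial.\<close>

definition gplus :: "real \<Rightarrow> real" where
  "gplus \<tau> = Inf (g ` ({\<tau><..} \<inter> {a..b}))"

definition gminus :: "real \<Rightarrow> real" where
  "gminus \<tau> = Sup (g ` ({..<\<tau>} \<inter> {a..b}))"

lemma gplus_tendsto:
  assumes "a \<le> \<tau>"
  shows "(g \<longlongrightarrow> gplus \<tau>) (at \<tau> within ({\<tau><..} \<inter> {a..b}))"
  unfolding gplus_def
  by (rule Lim_right_bound[where K = "g a"]) (use assms g_le in auto)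

lemma gminus_tendsto:
  assumes "\<tau> \<le> b"
  shows "(g \<longlongrightarrow> gminus \<tau>) (at \<tau> within ({..<\<tau>} \<inter> {a..b}))"
  unfolding gminus_def
  by (rule Lim_left_bound[where K = "g b"]) (use assms g_le in auto)

lemma gplus_bounds:
  assumes "a \<le> \<tau>" "\<tau> < t" "t \<le> b"
  shows "g \<tau> \<le> gplus \<tau>" "gplus \<tau> \<le> g t"
proof -
  show "g \<tau> \<le> gplus \<tau>"
    unfolding gplus_def using assms g_le by (intro cInf_greatest) auto
  show "gplus \<tau> \<le> g t"
    unfolding gplus_def using assms g_le by (intro cInf_lower bdd_belowI[of _ "g a"]) auto
qed

lemma gminus_bounds:
  assumes "a \<le> t" "t < \<tau>" "\<tau> \<le> b"
  shows "gminus \<tau> \<le> g \<tau>" "g t \<le> gminus \<tau>"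
proof -
  show "gminus \<tau> \<le> g \<tau>"
    unfolding gminus_def using assms g_le by (intro cSup_least) auto
  show "g t \<le> gminus \<tau>"
    unfolding gminus_def using assms g_le by (intro cSup_upper bdd_aboveI[of _ "g b"]) auto
qed

text \<open>Bounds the distance of two chain states whose times differ by the
  \<open>g\<close>-increment \<open>s\<close>: \<open>M * s\<close> for the deviation from a
  comparison curve and \<open>\<zeta> s\<close> for the movement of that curve.\<close>

definition spread :: "real \<Rightarrow> real \<Rightarrow> real" where
  "spread M s = M * s + \<zeta> s"

lemma spread_mono: "0 \<le> M \<Longrightarrow> 0 \<le> s \<Longrightarrow> s \<le> t \<Longrightarrow> spread M s \<le> spread M t"
  unfolding spread_def using modulus_mono[OF \<zeta>] by (intro add_mono mult_left_mono) auto

lemma spread_nonneg: "0 \<le> M \<Longrightarrow> 0 \<le> s \<Longrightarrow> 0 \<le> spread M s"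
  unfolding spread_def using modulus_nonneg[OF \<zeta>] by auto

text \<open>The one-sided limits replace the values \<open>g (p i)\<close> of
  \<open>chain_forward\<close> and \<open>chain_backward\<close>, which depend on the chain; this
  makes the bound uniform over all chains with the same \<open>M\<close>.\<close>

definition err :: "real \<Rightarrow> real \<Rightarrow> real \<Rightarrow> real" where
  "err M \<tau> t = \<omega> (spread M \<bar>g t - g \<tau>\<bar> + \<bar>t - \<tau>\<bar>)
     * \<bar>g t - (if \<tau> < t then gplus \<tau> else gminus \<tau>)\<bar>"

text \<open>If \<open>l = g \<tau>\<close> then the first factor tends to \<open>\<omega> 0 = 0\<close> and the second one is at most
  \<open>\<bar>g t - g \<tau>\<bar>\<close>; otherwise the second factor tends to 0 while \<open>\<bar>g t - g \<tau>\<bar>\<close> stays away from 0.\<close>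

lemma err_small_filter:
  assumes M: "0 \<le> M" and \<eta>: "0 < \<eta>"
    and gl: "(g \<longlongrightarrow> l) \<F>" and id: "((\<lambda>t. t) \<longlongrightarrow> \<tau>) \<F>"
    and ev: "\<forall>\<^sub>F t in \<F>. \<bar>l - g \<tau>\<bar> \<le> \<bar>g t - g \<tau>\<bar> \<and> \<bar>g t - l\<bar> \<le> \<bar>g t - g \<tau>\<bar>"
  shows "\<forall>\<^sub>F t in \<F>. \<omega> (spread M \<bar>g t - g \<tau>\<bar> + \<bar>t - \<tau>\<bar>) * \<bar>g t - l\<bar> \<le> \<eta> * \<bar>g t - g \<tau>\<bar>"
proof -
  let ?w = "\<lambda>t. \<omega> (spread M \<bar>g t - g \<tau>\<bar> + \<bar>t - \<tau>\<bar>)"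
  have gd: "((\<lambda>t. \<bar>g t - g \<tau>\<bar>) \<longlongrightarrow> \<bar>l - g \<tau>\<bar>) \<F>"
    by (intro tendsto_intros gl)
  have z: "((\<lambda>t. \<zeta> \<bar>g t - g \<tau>\<bar>) \<longlongrightarrow> \<zeta> \<bar>l - g \<tau>\<bar>) \<F>"
    by (rule continuous_on_tendsto_compose[OF modulus_cont[OF \<zeta>] gd]) auto
  have "((\<lambda>t. spread M \<bar>g t - g \<tau>\<bar> + \<bar>t - \<tau>\<bar>) \<longlongrightarrow> spread M \<bar>l - g \<tau>\<bar> + \<bar>\<tau> - \<tau>\<bar>) \<F>"
    unfolding spread_def by (intro tendsto_intros gd z id)
  then have w: "(?w \<longlongrightarrow> \<omega> (spread M \<bar>l - g \<tau>\<bar> + \<bar>\<tau> - \<tau>\<bar>)) \<F>"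
    by (rule continuous_on_tendsto_compose[OF modulus_cont[OF \<omega>]])
       (use M spread_nonneg in \<open>auto intro!: add_nonneg_nonneg\<close>)
  have wn: "0 \<le> ?w t" for t
    using M spread_nonneg modulus_nonneg[OF \<omega>] by simp
  show ?thesis
  proof (cases "l = g \<tau>")
    case True
    then have "(?w \<longlongrightarrow> 0) \<F>"
      using w by (simp add: spread_def modulus_zero[OF \<zeta>] modulus_zero[OF \<omega>])
    then have "\<forall>\<^sub>F t in \<F>. ?w t < \<eta>"
      using \<eta> by (rule order_tendstoD)
    then show ?thesis
      by eventually_elim (use True in \<open>auto intro: mult_right_mono\<close>)
  next
    case False
    have "((\<lambda>t. ?w t * \<bar>g t - l\<bar>) \<longlongrightarrow> \<omega> (spread M \<bar>l - g \<tau>\<bar> + \<bar>\<tau> - \<tau>\<bar>) * \<bar>l - l\<bar>) \<F>"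
      by (intro tendsto_intros w gl)
    then have "((\<lambda>t. ?w t * \<bar>g t - l\<bar>) \<longlongrightarrow> 0) \<F>"
      by simp
    moreover have "0 < \<eta> * \<bar>l - g \<tau>\<bar>"
      using \<eta> False by simp
    ultimately have "\<forall>\<^sub>F t in \<F>. ?w t * \<bar>g t - l\<bar> < \<eta> * \<bar>l - g \<tau>\<bar>"
      by (rule order_tendstoD)
    with ev show ?thesis
    proof eventually_elim
      case (elim t)
      then have "\<eta> * \<bar>l - g \<tau>\<bar> \<le> \<eta> * \<bar>g t - g \<tau>\<bar>"
        using \<eta> by (intro mult_left_mono) auto
      with elim show ?case by linarith
    qed
  qed
qed

lemma err_small:
  assumes M: "0 \<le> M" and \<eta>: "0 < \<eta>" and \<tau>: "\<tau> \<in> {a..b}"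
  shows "\<exists>\<delta>>0. \<forall>t\<in>{a..b}. \<bar>t - \<tau>\<bar> < \<delta> \<longrightarrow> t \<noteq> \<tau> \<longrightarrow> err M \<tau> t \<le> \<eta> * \<bar>g t - g \<tau>\<bar>"
proof -
  let ?R = "{\<tau><..} \<inter> {a..b}" and ?L = "{..<\<tau>} \<inter> {a..b}"
  have "\<bar>gplus \<tau> - g \<tau>\<bar> \<le> \<bar>g t - g \<tau>\<bar> \<and> \<bar>g t - gplus \<tau>\<bar> \<le> \<bar>g t - g \<tau>\<bar>"
    if "t \<in> ?R" for t
    using gplus_bounds[of \<tau> t] that \<tau> by auto
  then have "\<forall>\<^sub>F t in at \<tau> within ?R.
      \<bar>gplus \<tau> - g \<tau>\<bar> \<le> \<bar>g t - g \<tau>\<bar> \<and> \<bar>g t - gplus \<tau>\<bar> \<le> \<bar>g t - g \<tau>\<bar>"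
    unfolding eventually_at_filter by (intro always_eventually) blast
  then have "\<forall>\<^sub>F t in at \<tau> within ?R. \<omega> (spread M \<bar>g t - g \<tau>\<bar> + \<bar>t - \<tau>\<bar>) * \<bar>g t - gplus \<tau>\<bar> \<le> \<eta> * \<bar>g t - g \<tau>\<bar>"
    using gplus_tendsto[of \<tau>] \<tau> by (intro err_small_filter[OF M \<eta>] tendsto_ident_at) auto
  then obtain d1 where d1: "d1 > 0" "\<And>t. t \<in> ?R \<Longrightarrow> \<bar>t - \<tau>\<bar> < d1 \<Longrightarrow> err M \<tau> t \<le> \<eta> * \<bar>g t - g \<tau>\<bar>"
    unfolding eventually_at by (auto simp: err_def dist_real_def)
  have "\<bar>gminus \<tau> - g \<tau>\<bar> \<le> \<bar>g t - g \<tau>\<bar> \<and> \<bar>g t - gminus \<tau>\<bar> \<le> \<bar>g t - g \<tau>\<bar>"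
    if "t \<in> ?L" for t
    using gminus_bounds[of t \<tau>] that \<tau> by auto
  then have "\<forall>\<^sub>F t in at \<tau> within ?L.
      \<bar>gminus \<tau> - g \<tau>\<bar> \<le> \<bar>g t - g \<tau>\<bar> \<and> \<bar>g t - gminus \<tau>\<bar> \<le> \<bar>g t - g \<tau>\<bar>"
    unfolding eventually_at_filter by (intro always_eventually) blast
  then have "\<forall>\<^sub>F t in at \<tau> within ?L. \<omega> (spread M \<bar>g t - g \<tau>\<bar> + \<bar>t - \<tau>\<bar>) * \<bar>g t - gminus \<tau>\<bar> \<le> \<eta> * \<bar>g t - g \<tau>\<bar>"
    using gminus_tendsto[of \<tau>] \<tau> by (intro err_small_filter[OF M \<eta>] tendsto_ident_at) auto
  then obtain d2 where d2: "d2 > 0" "\<And>t. t \<in> ?L \<Longrightarrow> \<bar>t - \<tau>\<bar> < d2 \<Longrightarrow> err M \<tau> t \<le> \<eta> * \<bar>g t - g \<tau>\<bar>"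
    unfolding eventually_at by (auto simp: err_def dist_real_def)
  have "err M \<tau> t \<le> \<eta> * \<bar>g t - g \<tau>\<bar>"
    if "t \<in> {a..b}" "\<bar>t - \<tau>\<bar> < min d1 d2" "t \<noteq> \<tau>" for t
  proof (cases "\<tau> < t")
    case True
    then show ?thesis
      using that by (intro d1(2)) auto
  next
    case False
    then show ?thesis
      using that by (intro d2(2)) auto
  qed
  moreover have "min d1 d2 > 0"
    using d1(1) d2(1) by simp
  ultimately show ?thesis
    by blast
qed

section \<open>Error bounds for chains\<close>

text \<open>The curve \<open>F (x i) (\<tau> i)\<close> starts at \<open>x i\<close>. Until
  \<open>\<tau> j\<close> the chain deviates from it by at most \<open>M\<close> times the increment
  of \<open>g\<close>, and the curve itself moves by at most \<open>\<zeta>\<close> of that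
  increment.\<close>

lemma chain_spread:
  assumes ch: "chain m \<tau> p x" and M: "0 \<le> M"
    and all: "\<And>i j. i \<le> m \<Longrightarrow> j \<le> m \<Longrightarrow> \<omega> (dist (x i) (x j) + \<bar>\<tau> i - \<tau> j\<bar>) \<le> M"
    and ij: "i \<le> j" "j \<le> m"
  shows "dist (x i) (x j) \<le> spread M (g (\<tau> j) - g (\<tau> i))"
proof -
  note mem = chain_mem[OF ch, of i] chain_mem[OF ch, of j]
  have le: "\<tau> i \<le> \<tau> j"
    using chain_mono[OF ch] ij by simp
  have "\<bar>dist (x j) (F (x i) (\<tau> i) (\<tau> j)) - dist (x i) (F (x i) (\<tau> i) (\<tau> i))\<bar>
      \<le> M * (g (\<tau> j) - g (\<tau> i))"
    using all ij mem by (intro chain_telescope[OF ch]) auto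
  moreover have "F (x i) (\<tau> i) (\<tau> i) = x i"
    using F_diag mem ij by simp
  moreover have "dist (F (x i) (\<tau> i) (\<tau> j)) (F (x i) (\<tau> i) (\<tau> i)) \<le> \<zeta> (g (\<tau> j) - g (\<tau> i))"
    using F_var[of "x i" "\<tau> i" "\<tau> j" "\<tau> i"] mem ij g_le[of "\<tau> i" "\<tau> j"] le by auto
  ultimately show ?thesis
    unfolding spread_def
    using dist_triangle2[of "x j" "x i" "F (x i) (\<tau> i) (\<tau> j)"]
    by (auto simp: dist_commute)
qed

text \<open>A bootstrap: the crude bound \<open>M\<close> on the modulus factor gives
  \<open>chain_spread\<close>, which bounds the argument of \<open>\<omega>\<close> again, now in
  terms of \<open>g\<close> and the times. With this sharper factor in place of \<open>M\<close>,
  the forward and backward estimates give \<open>err\<close>.\<close>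

lemma chain_err:
  assumes ch: "chain m \<tau> p x" and M: "0 \<le> M"
    and all: "\<And>i j. i \<le> m \<Longrightarrow> j \<le> m \<Longrightarrow> \<omega> (dist (x i) (x j) + \<bar>\<tau> i - \<tau> j\<bar>) \<le> M"
    and ik: "i \<le> m" "k \<le> m" "i \<noteq> k"
  shows "dist (x k) (F (x i) (\<tau> i) (\<tau> k)) \<le> err M (\<tau> i) (\<tau> k)"
proof -
  \<comment> \<open>The indices \<open>q\<close> and \<open>r\<close> delimit the range, and
    \<open>l\<close> is the end at which the tag sits: the left one going forward, the right one
    going backward.\<close>
  have key: "\<omega> (dist (x j) (x l) + \<bar>\<tau> j - \<tau> l\<bar>) \<le> \<omega> (spread M \<bar>g (\<tau> q) - g (\<tau> r)\<bar> + \<bar>\<tau> q - \<tau> r\<bar>)"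
    if "q \<le> j" "j \<le> r" "r \<le> m" "l = q \<or> l = r" for q r j l
  proof -
    note mem = chain_mem(1)[OF ch, of q] chain_mem(1)[OF ch, of r] chain_mem(1)[OF ch, of j]
    have t: "\<tau> q \<le> \<tau> j" "\<tau> j \<le> \<tau> r"
      using chain_mono[OF ch] that by auto
    have G: "g (\<tau> q) \<le> g (\<tau> j)" "g (\<tau> j) \<le> g (\<tau> r)"
      using t mem that by (auto intro!: g_le)
    have "dist (x j) (x l) \<le> spread M \<bar>g (\<tau> l) - g (\<tau> j)\<bar>"
      using that(4)
    proof
      assume "l = q"
      then show ?thesis
        using chain_spread[OF ch M all, of q j] that G by (simp add: dist_commute)
    next
      assume "l = r"
      then show ?thesis
        using chain_spread[OF ch M all, of j r] that G by simp
    qed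
    also have "\<dots> \<le> spread M \<bar>g (\<tau> q) - g (\<tau> r)\<bar>"
      using M that G by (intro spread_mono) auto
    finally have "dist (x j) (x l) + \<bar>\<tau> j - \<tau> l\<bar> \<le> spread M \<bar>g (\<tau> q) - g (\<tau> r)\<bar> + \<bar>\<tau> q - \<tau> r\<bar>"
      using that t by auto
    then show ?thesis
      by (intro modulus_mono[OF \<omega>]) auto
  qed
  have wn: "0 \<le> \<omega> (spread M \<bar>g (\<tau> k) - g (\<tau> i)\<bar> + \<bar>\<tau> k - \<tau> i\<bar>)"
    using M spread_nonneg by (intro modulus_nonneg[OF \<omega>]) simp
  note mem = chain_mem(1)[OF ch, of i] chain_mem(1)[OF ch, of k]
  from ik consider "i < k" | "k < i" by linarith
  then show ?thesis
  proof cases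
    case 1
    let ?W = "\<omega> (spread M \<bar>g (\<tau> k) - g (\<tau> i)\<bar> + \<bar>\<tau> k - \<tau> i\<bar>)"
    have st: "\<tau> i < p i" "p i \<in> {a..b}" "p i < \<tau> k"
      using chain_step[OF ch, of i] chain_mono[OF ch, of "Suc i" k] 1 ik by auto
    have "dist (x k) (F (x i) (\<tau> i) (\<tau> k)) \<le> ?W * (g (\<tau> k) - g (p i))"
      using 1 ik key[of i _ k i] by (intro chain_forward[OF ch]) (auto simp: abs_minus_commute)
    \<comment> \<open>Since \<open>p i\<close> lies strictly to the right of
      \<open>\<tau> i\<close>, the right limit there is at most \<open>g (p i)\<close>.\<close>
    also have "\<dots> \<le> ?W * \<bar>g (\<tau> k) - gplus (\<tau> i)\<bar>"
      using gplus_bounds(2)[of "\<tau> i" "p i"] st mem ik wn by (intro mult_left_mono) auto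
    finally show ?thesis
      using st by (simp add: err_def)
  next
    case 2
    then obtain l where l: "i = Suc l" "k \<le> l"
      by (cases i) auto
    let ?W = "\<omega> (spread M \<bar>g (\<tau> k) - g (\<tau> i)\<bar> + \<bar>\<tau> k - \<tau> i\<bar>)"
    have st: "p l < \<tau> i" "p l \<in> {a..b}" "\<tau> k < p l"
      using chain_step[OF ch, of l] chain_mono[OF ch, of k l] l ik by auto
    have "dist (x k) (F (x i) (\<tau> i) (\<tau> k)) \<le> ?W * (g (p l) - g (\<tau> k))"
      using l ik key[of k _ i i] unfolding l(1) by (intro chain_backward[OF ch]) auto
    also have "\<dots> \<le> ?W * \<bar>g (\<tau> k) - gminus (\<tau> i)\<bar>"
      using gminus_bounds(2)[of "p l" "\<tau> i"] st mem ik wn by (intro mult_left_mono) auto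
    finally show ?thesis
      using st by (simp add: err_def)
  qed
qed

section \<open>Construction of chains near \<open>L\<close>\<close>

text \<open>The radius is spent in thirds. Just before the next time the chain is within
  \<open>r / 3\<close> of the curve \<open>F x0 a\<close>, which is within \<open>r / 3\<close> of
  \<open>L\<close>; solvability then supplies the next state, and \<open>\<zeta>\<close> allows it
  to move by another \<open>r / 3\<close>. The initial state is exempt from the ball because
  \<open>F x0 a\<close> may jump right after \<open>a\<close>.\<close>

lemma chain_exists:
  fixes x0 L :: 'a and r c :: real
  assumes x0: "x0 \<in> \<Omega>" and c: "a < c" "c \<le> b" and r: "0 < r" "cball L r \<subseteq> \<Omega>"
    and solv: "\<And>\<tau>. \<tau> \<in> {a<..c} \<Longrightarrow>
      \<exists>\<mu>>0. \<forall>x\<in>cball L r. \<forall>t\<in>{\<tau> - \<mu><..<\<tau>} \<inter> {a..b}. \<exists>y\<in>\<Omega>. F y \<tau> t = x"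
    and near: "\<And>t. t \<in> {a<..c} \<Longrightarrow> dist (F x0 a t) L \<le> r / 3"
    and M: "M = \<omega> (2 * r + dist x0 L + (b - a))"
    and small: "\<And>s t. a < s \<Longrightarrow> s \<le> t \<Longrightarrow> t \<le> c \<Longrightarrow> M * (g t - g s) \<le> r / 3 \<and> \<zeta> (g t - g s) \<le> r / 3"
    and \<tau>: "\<And>i. i < m \<Longrightarrow> \<tau> i < \<tau> (Suc i)" "\<tau> 0 = a" "\<tau> m \<le> c"
  shows "\<exists>p x. chain m \<tau> p x \<and> x 0 = x0 \<and> (\<forall>i\<in>{1..m}. x i \<in> cball L r)"
  using \<tau>
proof (induction m)
  case 0
  then show ?case
    using x0 c by (intro exI[of _ "\<lambda>_. a"] exI[of _ "\<lambda>_. x0"]) (simp add: chain_def)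
next
  case (Suc m)
  have "\<tau> m \<le> c"
    using Suc.prems(1)[of m] Suc.prems(3) by simp
  then have "\<exists>p x. chain m \<tau> p x \<and> x 0 = x0 \<and> (\<forall>i\<in>{1..m}. x i \<in> cball L r)"
    using Suc.IH Suc.prems(1,2) by simp
  then obtain p x where ch: "chain m \<tau> p x" and x: "x 0 = x0" "\<And>i. i \<in> {1..m} \<Longrightarrow> x i \<in> cball L r"
    by blast
  have \<tau>m: "\<tau> m < \<tau> (Suc m)" "\<tau> m \<in> {a..b}" "\<tau> (Suc m) \<in> {a<..c}" "x m \<in> \<Omega>"
    using Suc.prems(1)[of m] Suc.prems(3) chain_mem[OF ch, of m] by auto
  obtain \<mu> where \<mu>: "\<mu> > 0"
    "\<And>x t. x \<in> cball L r \<Longrightarrow> t \<in> {\<tau> (Suc m) - \<mu><..<\<tau> (Suc m)} \<inter> {a..b} \<Longrightarrow> \<exists>y\<in>\<Omega>. F y (\<tau> (Suc m)) t = x"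
    using solv[OF \<tau>m(3)] by blast
  \<comment> \<open>The new intermediate time must follow \<open>\<tau> m\<close> and lie in the
    window of length \<open>\<mu>\<close> where solvability holds.\<close>
  obtain q where q: "max (\<tau> m) (\<tau> (Suc m) - \<mu>) < q" "q < \<tau> (Suc m)"
    using dense[of "max (\<tau> m) (\<tau> (Suc m) - \<mu>)" "\<tau> (Suc m)"] \<tau>m \<mu> by auto
  then have q': "q \<in> {a<..c}" "q \<in> {a..b}" "\<tau> m < q"
    using \<tau>m c by auto
  define z where "z = F (x m) (\<tau> m) q"
  have zF: "dist z (F x0 a q) \<le> r / 3"
  proof (cases "m = 0")
    case True
    then show ?thesis
      using x Suc.prems r by (simp add: z_def)
  next
    case False
    \<comment> \<open>Only states after the initial one occur, since \<open>chain_forward\<close> is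
      applied from index 0; they lie in the ball.\<close>
    have W: "\<omega> (dist (x j) x0 + \<bar>\<tau> j - \<tau> 0\<bar>) \<le> M" if "0 < j" "j \<le> m" for j
    proof -
      have "dist (x j) x0 \<le> r + dist x0 L"
        using x(2)[of j] that dist_triangle[of "x j" x0 L] by (auto simp: dist_commute)
      moreover have "\<bar>\<tau> j - \<tau> 0\<bar> \<le> b - a"
        using chain_mem(1)[OF ch, of j] chain_mem(1)[OF ch, of 0] that by auto
      ultimately show ?thesis
        unfolding M using r by (intro modulus_mono[OF \<omega>]) auto
    qed
    have "dist (x m) (F (x 0) (\<tau> 0) (\<tau> m)) \<le> M * (g (\<tau> m) - g (p 0))"
      using False W x by (intro chain_forward[OF ch]) auto
    moreover have "\<bar>dist (F (x m) (\<tau> m) q) (F x0 a q) - dist (F (x m) (\<tau> m) (\<tau> m)) (F x0 a (\<tau> m))\<bar>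
        \<le> M * (g q - g (\<tau> m))"
      using \<tau>m q' W[of m] False x0 c Suc.prems by (intro F_comp_abs) auto
    moreover have "F (x m) (\<tau> m) (\<tau> m) = x m"
      using F_diag \<tau>m by simp
    \<comment> \<open>The increment starts at \<open>p 0\<close>, which exceeds \<open>a\<close>, so
      \<open>small\<close> applies even if \<open>g\<close> jumps at \<open>a\<close>.\<close>
    moreover have "M * (g q - g (p 0)) \<le> r / 3"
      using small[of "p 0" q] chain_step[OF ch, of 0] chain_mono[OF ch, of 1 m] False Suc.prems q' by auto
    ultimately show ?thesis
      using x Suc.prems by (simp add: z_def algebra_simps)
  qed
  then have zL: "dist z L \<le> 2 * r / 3"
    using near[OF q'(1)] dist_triangle[of z L "F x0 a q"] by simp
  then obtain y where y: "y \<in> \<Omega>" "F y (\<tau> (Suc m)) q = z"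
    using \<mu>(2)[of z q] q q' r by (auto simp: dist_commute)
  have "dist (F y (\<tau> (Suc m)) (\<tau> (Suc m))) (F y (\<tau> (Suc m)) q) \<le> \<zeta> \<bar>g (\<tau> (Suc m)) - g q\<bar>"
    using y q' \<tau>m c by (intro F_var) auto
  moreover have "g q \<le> g (\<tau> (Suc m))"
    using q q' \<tau>m c by (intro g_le) auto
  moreover have "\<zeta> (g (\<tau> (Suc m)) - g q) \<le> r / 3"
    using small[of q "\<tau> (Suc m)"] q q' \<tau>m by auto
  moreover have "F y (\<tau> (Suc m)) (\<tau> (Suc m)) = y"
    using F_diag y \<tau>m c by auto
  ultimately have "dist y z \<le> r / 3"
    using y by simp
  then have yL: "y \<in> cball L r"
    using zL dist_triangle[of y L z] by (simp add: dist_commute)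
  have "chain (Suc m) \<tau> (p(m := q)) (x(Suc m := y))"
    using ch \<tau>m q q' y c unfolding chain_def z_def by (auto simp: le_Suc_eq less_Suc_eq)
  moreover have "(x(Suc m := y)) i \<in> cball L r" if "i \<in> {1..Suc m}" for i
    using that yL x(2)[of i] by (auto simp: le_Suc_eq)
  ultimately show ?case
    using x(1) by (intro exI[of _ "p(m := q)"] exI[of _ "x(Suc m := y)"] conjI ballI) (assumption | simp)+
qed

section \<open>The local solution by compactness\<close>

lemma local_solution:
  fixes x0 L :: 'a and r c :: real
  assumes x0: "x0 \<in> \<Omega>" and c: "a < c" "c \<le> b" and r: "0 < r" "cball L r \<subseteq> \<Omega>"
    and comp: "compact (cball L r)"
    and solv: "\<And>\<tau>. \<tau> \<in> {a<..c} \<Longrightarrow>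
      \<exists>\<mu>>0. \<forall>x\<in>cball L r. \<forall>t\<in>{\<tau> - \<mu><..<\<tau>} \<inter> {a..b}. \<exists>y\<in>\<Omega>. F y \<tau> t = x"
    and near: "\<And>t. t \<in> {a<..c} \<Longrightarrow> dist (F x0 a t) L \<le> r / 3"
    and M: "M = \<omega> (2 * r + dist x0 L + (b - a))"
    and small: "\<And>s t. a < s \<Longrightarrow> s \<le> t \<Longrightarrow> t \<le> c \<Longrightarrow> M * (g t - g s) \<le> r / 3 \<and> \<zeta> (g t - g s) \<le> r / 3"
  shows "\<exists>u. is_solution \<Omega> F {a..c} u \<and> u a = x0"
proof -
  have M0: "0 \<le> M"
    unfolding M using r c by (intro modulus_nonneg[OF \<omega>]) auto
  \<comment> \<open>The singleton at \<open>a\<close> encodes the initial condition.\<close>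
  define K where "K = (\<lambda>t. if t = a then {x0} else cball L r)"
  \<comment> \<open>Pairs are confined to the compact sets because \<open>F\<close> is continuous
    only on \<open>\<Omega>\<close>; the diagonal is exempt because \<open>chain_err\<close>
    concerns distinct indices.\<close>
  define P where "P = (\<lambda>s t. {(y, z) \<in> K s \<times> K t. s = t \<or> dist z (F y s t) \<le> err M s t})"
  have K: "compact (K t)" "K t \<noteq> {}" "K t \<subseteq> \<Omega>" for t
    using comp r x0 by (auto simp: K_def)
  have closed_P: "closed (P s t)" if "s \<in> {a..c}" "t \<in> {a..c}" for s t
  proof (cases "s = t")
    case True
    then have "P s t = K s \<times> K t"
      by (auto simp: P_def)
    then show ?thesis
      using K by (simp add: closed_Times compact_imp_closed)
  next
    case False
    have "continuous_on (K s) (\<lambda>x. F x s t)"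
      using F_cont[of s t] that c K(3)[of s] by (auto intro: continuous_on_subset)
    then have "continuous_on (K s \<times> K t) (\<lambda>q. F (fst q) s t)"
      by (rule continuous_on_compose2[where f = fst]) (auto intro!: continuous_intros)
    then have "continuous_on (K s \<times> K t) (\<lambda>q. dist (snd q) (F (fst q) s t))"
      by (intro continuous_intros)
    then have "closed ((K s \<times> K t) \<inter> (\<lambda>q. dist (snd q) (F (fst q) s t)) -` {..err M s t})"
      using K by (intro continuous_closed_preimage) (auto simp: closed_Times compact_imp_closed)
    also have "(K s \<times> K t) \<inter> (\<lambda>q. dist (snd q) (F (fst q) s t)) -` {..err M s t} = P s t"
      using False by (auto simp: P_def)
    finally show ?thesis .
  qed
  have finite_sel: "\<exists>v. (\<forall>t\<in>T. v t \<in> K t) \<and> (\<forall>s\<in>T. \<forall>t\<in>T. (v s, v t) \<in> P s t)"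
    if T: "finite T" "T \<subseteq> {a..c}" for T
  proof -
    \<comment> \<open>Adding \<open>a\<close> makes every chain start at the initial time, whether
      or not \<open>a\<close> belongs to \<open>T\<close>.\<close>
    define xs where "xs = sorted_list_of_set (insert a T)"
    define m where "m = length xs - 1"
    define \<tau> where "\<tau> = (\<lambda>i. xs ! i)"
    have set_xs: "set xs = insert a T" and sorted: "sorted_wrt (<) xs"
      using T set_sorted_list_of_set[of "insert a T"] strict_sorted_list_of_set[of "insert a T"]
      by (simp_all only: xs_def finite_insert)
    then have len: "length xs = Suc m"
      by (cases xs) (auto simp: m_def)
    have \<tau>_less: "\<tau> i < \<tau> j" if "i < j" "j \<le> m" for i j
      using sorted_wrt_nth_less[OF sorted] that len by (auto simp: \<tau>_def)
    have \<tau>_mem: "\<tau> i \<in> insert a T" if "i \<le> m" for i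
      using nth_mem[of i xs] that len set_xs by (auto simp: \<tau>_def)
    have "\<exists>i\<le>m. \<tau> i = t" if "t \<in> insert a T" for t
      using that unfolding set_xs[symmetric] in_set_conv_nth len less_Suc_eq_le \<tau>_def by blast
    then obtain n where n: "\<And>t. t \<in> insert a T \<Longrightarrow> n t \<le> m" "\<And>t. t \<in> insert a T \<Longrightarrow> \<tau> (n t) = t"
      by metis
    have ge: "a \<le> \<tau> i" "\<tau> i \<le> c" if "i \<le> m" for i
      using \<tau>_mem[OF that] T c by auto
    have na: "n a = 0"
      using \<tau>_less[of 0 "n a"] n[of a] ge[of 0] by fastforce
    then have \<tau>0: "\<tau> 0 = a"
      using n[of a] by simp
    obtain p x where ch: "chain m \<tau> p x" and x: "x 0 = x0" "\<And>i. i \<in> {1..m} \<Longrightarrow> x i \<in> cball L r"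
      using chain_exists[OF x0 c r solv near M small, of m \<tau>] \<tau>_less \<tau>0 ge(2)[of m] by auto
    have xL: "dist (x i) L \<le> r \<or> x i = x0" if "i \<le> m" for i
      using x(1) x(2)[of i] that by (cases "i = 0") (auto simp: dist_commute)
    \<comment> \<open>Two states are both in the ball, or one of them is \<open>x0\<close>;
      \<open>2 * r + dist x0 L\<close> covers all cases and explains the choice of
      \<open>M\<close>.\<close>
    have all: "\<omega> (dist (x i) (x j) + \<bar>\<tau> i - \<tau> j\<bar>) \<le> M" if "i \<le> m" "j \<le> m" for i j
    proof -
      have "dist (x i) (x j) \<le> 2 * r + dist x0 L"
        using xL[OF that(1)] xL[OF that(2)] dist_triangle2[of "x i" "x j" L] r zero_le_dist[of x0 L] dist_self[of x0]
        by (smt (verit))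
      moreover have "\<bar>\<tau> i - \<tau> j\<bar> \<le> b - a"
        using ge[OF that(1)] ge[OF that(2)] c by auto
      ultimately show ?thesis
        unfolding M by (intro modulus_mono[OF \<omega>]) auto
    qed
    have vK: "x (n t) \<in> K t" if "t \<in> T" for t
    proof (cases "t = a")
      case True
      then show ?thesis
        using na x by (simp add: K_def)
    next
      case False
      then have "n t \<noteq> 0"
        using n(2)[of t] that \<tau>0 by (metis insertI2)
      then show ?thesis
        using x(2)[of "n t"] n(1)[of t] that False by (simp add: K_def)
    qed
    moreover have "(x (n s), x (n t)) \<in> P s t" if "s \<in> T" "t \<in> T" for s t
    proof (cases "s = t")
      case False
      then have "dist (x (n t)) (F (x (n s)) (\<tau> (n s)) (\<tau> (n t))) \<le> err M (\<tau> (n s)) (\<tau> (n t))"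
        using n[of s] n[of t] that by (intro chain_err[OF ch M0 all]) auto
      then show ?thesis
        using n[of s] n[of t] that vK by (simp add: P_def)
    qed (use that vK in \<open>simp add: P_def\<close>)
    ultimately show ?thesis
      by (intro exI[of _ "x \<circ> n"]) simp
  qed
  obtain u where u: "\<And>t. t \<in> {a..c} \<Longrightarrow> u t \<in> K t"
    "\<And>s t. s \<in> {a..c} \<Longrightarrow> t \<in> {a..c} \<Longrightarrow> (u s, u t) \<in> P s t"
    using compact_pairwise_selection[of "{a..c}" K P, OF K(1,2) closed_P finite_sel] by blast
  have "\<exists>\<delta>>0. \<forall>t\<in>{a..c}. \<bar>t - \<tau>\<bar> < \<delta> \<longrightarrow> dist (u t) (F (u \<tau>) \<tau> t) \<le> \<eta> * \<bar>g t - g \<tau>\<bar>"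
    if \<tau>: "\<tau> \<in> {a..c}" and \<eta>: "\<eta> > 0" for \<tau> \<eta>
  proof -
    obtain \<delta> where \<delta>: "\<delta> > 0"
      "\<And>t. t \<in> {a..b} \<Longrightarrow> \<bar>t - \<tau>\<bar> < \<delta> \<Longrightarrow> t \<noteq> \<tau> \<Longrightarrow> err M \<tau> t \<le> \<eta> * \<bar>g t - g \<tau>\<bar>"
      using err_small[OF M0 \<eta>, of \<tau>] \<tau> c by auto
    have "dist (u t) (F (u \<tau>) \<tau> t) \<le> \<eta> * \<bar>g t - g \<tau>\<bar>" if t: "t \<in> {a..c}" "\<bar>t - \<tau>\<bar> < \<delta>" for t
    proof (cases "t = \<tau>")
      case True
      then show ?thesis
        using F_diag[of "u \<tau>" \<tau>] u(1)[OF \<tau>] K(3)[of \<tau>] \<tau> c by auto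
    next
      case False
      then have "dist (u t) (F (u \<tau>) \<tau> t) \<le> err M \<tau> t"
        using u(2)[OF \<tau> t(1)] by (simp add: P_def)
      also have "\<dots> \<le> \<eta> * \<bar>g t - g \<tau>\<bar>"
        using \<delta>(2)[of t] t c False by simp
      finally show ?thesis .
    qed
    then show ?thesis
      using \<delta>(1) by blast
  qed
  moreover have "u \<tau> \<in> \<Omega>" if "\<tau> \<in> {a..c}" for \<tau>
    using u(1)[OF that] K(3) by blast
  moreover have "mono_on {a..c} g"
    using c by (intro mono_on_subset[OF g_mono]) auto
  ultimately have "is_solution \<Omega> F {a..c} u"
    by (intro is_solutionI_local[where g = g])
  moreover have "u a = x0"
    using u(1)[of a] c by (simp add: K_def)
  ultimately show ?thesis
    by blast
qed

end

section \<open>Choice of the interval and conclusion\<close>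

text \<open>For times after \<open>a\<close> all increments up to \<open>c\<close> are at most
  \<open>g c - l\<close> with \<open>l\<close> the right limit of \<open>g\<close> at
  \<open>a\<close>, and this tends to 0 even if \<open>g\<close> jumps at \<open>a\<close>.\<close>

lemma eventually_increments_small:
  fixes g \<omega> :: "real \<Rightarrow> real"
  assumes g: "mono_on {a..b} g" and \<omega>: "modulus_function \<omega>" and "a < b" "0 < e"
  shows "\<forall>\<^sub>F c in at_right a. \<forall>s t. a < s \<longrightarrow> s \<le> t \<longrightarrow> t \<le> c \<longrightarrow> \<omega> (g t - g s) \<le> e"
proof -
  have g_le: "g s \<le> g t" if "a \<le> s" "s \<le> t" "t \<le> b" for s t
    using that by (intro mono_onD[OF g]) auto
  define l where "l = Inf (g ` ({a<..} \<inter> {a..b}))"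
  have "(g \<longlongrightarrow> l) (at a within ({a<..} \<inter> {a..b}))"
    unfolding l_def by (rule Lim_right_bound[where K = "g a"]) (use g_le in auto)
  moreover have "at a within ({a<..} \<inter> {a..b}) = at_right a"
    using \<open>a < b\<close> by (intro at_within_nhd[of a "{..<b}"]) auto
  ultimately have gl: "(g \<longlongrightarrow> l) (at_right a)"
    by simp
  have l_le: "l \<le> g s" if "a < s" "s \<le> b" for s
    unfolding l_def using that g_le by (intro cInf_lower bdd_belowI[of _ "g a"]) auto
  \<comment> \<open>The maximum keeps the argument in the half-line on which \<open>\<omega>\<close>
    is continuous.\<close>
  have "((\<lambda>c. max 0 (g c - l)) \<longlongrightarrow> max 0 (l - l)) (at_right a)"
    by (intro tendsto_intros gl)
  from continuous_on_tendsto_compose[OF modulus_cont[OF \<omega>] this]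
  have "((\<lambda>c. \<omega> (max 0 (g c - l))) \<longlongrightarrow> 0) (at_right a)"
    by (simp add: modulus_zero[OF \<omega>])
  then have "\<forall>\<^sub>F c in at_right a. \<omega> (max 0 (g c - l)) < e"
    using \<open>0 < e\<close> by (rule order_tendstoD)
  moreover have "\<forall>\<^sub>F c in at_right a. c \<in> {a<..<b}"
    using \<open>a < b\<close> by (rule eventually_at_right_real)
  ultimately show ?thesis
  proof eventually_elim
    case (elim c)
    have "\<omega> (g t - g s) \<le> e" if "a < s" "s \<le> t" "t \<le> c" for s t
    proof -
      have "g s \<le> g t" "g t \<le> g c" "l \<le> g s"
        using that elim by (auto intro!: g_le l_le)
      then have "\<omega> (g t - g s) \<le> \<omega> (max 0 (g c - l))"
        by (intro modulus_mono[OF \<omega>]) auto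
      then show ?thesis
        using elim by simp
    qed
    then show ?case
      by blast
  qed
qed

text \<open>Makes \<open>eventually_increments_small\<close> applicable to
  \<open>M * (g t - g s)\<close>.\<close>

lemma modulus_function_scaled: "0 < M \<Longrightarrow> modulus_function (\<lambda>s. M * s)"
  by (auto simp: modulus_function_def mono_on_def intro!: continuous_intros)

lemma locally_compact_compact_cball:
  fixes L :: "'a::metric_space"
  assumes "locally_compact_space (euclidean :: 'a topology)" and "open V" "L \<in> V"
  shows "\<exists>r>0. cball L r \<subseteq> V \<and> compact (cball L r)"
proof -
  obtain W K where W: "open W" "compact K" "L \<in> W" "W \<subseteq> K"
    using assms(1) unfolding locally_compact_space_def by (metis UNIV_I compactin_euclidean_iff open_openin topspace_euclidean)
  obtain r where r: "r > 0" "cball L r \<subseteq> V \<inter> W"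
    using open_contains_cball[of "V \<inter> W"] W assms by blast
  then have "cball L r = K \<inter> cball L r"
    using W by auto
  then have "compact (cball L r)"
    using W(2) by (metis closed_cball compact_Int_closed)
  with r show ?thesis
    by blast
qed

theorem theorem6p5:
  fixes \<Omega> :: "'a::metric_space set"
    and F :: "'a \<Rightarrow> real \<Rightarrow> real \<Rightarrow> 'a"
    and a b :: real
    and x0 L :: 'a
  assumes "locally_compact_space (euclidean :: 'a topology)"
    and "open \<Omega>"
    and "a < b"
    and "\<forall>x\<in>\<Omega>. \<forall>\<tau>\<in>{a..b}. F x \<tau> \<tau> = x"
    and "x0 \<in> \<Omega>"
    and "((\<lambda>t. F x0 a t) \<longlongrightarrow> L) (at_right a)"
    and "L \<in> \<Omega>"
    and "\<forall>\<tau>\<in>{a..b}. \<forall>t\<in>{a..b}. continuous_on \<Omega> (\<lambda>x. F x \<tau> t)"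
    and "\<exists>h \<zeta>. strict_mono_on {a..b} h \<and> modulus_function \<zeta> \<and>
           (\<forall>x\<in>\<Omega>. \<forall>\<tau>\<in>{a..b}. \<forall>t\<in>{a..b}. \<forall>s\<in>{a..b}.
              dist (F x \<tau> t) (F x \<tau> s) \<le> \<zeta> \<bar>h t - h s\<bar>)"
    and "\<exists>U\<subseteq>\<Omega>. L \<in> interior U \<and>
           (\<forall>\<tau>\<in>{a<..b}. \<exists>\<mu>>0. \<forall>x\<in>U. \<forall>t\<in>{\<tau> - \<mu><..<\<tau>} \<inter> {a..b}. \<exists>y\<in>\<Omega>. F y \<tau> t = x)"
    and "\<exists>\<xi> \<omega>. strict_mono_on {a..b} \<xi> \<and> modulus_function \<omega> \<and>
           (\<forall>\<tau>\<in>{a..b}. \<forall>\<sigma>\<in>{a..b}. \<forall>t\<in>{a..b}. \<forall>s\<in>{a..b}. \<forall>x\<in>\<Omega>. \<forall>y\<in>\<Omega>.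
              dist (F x \<tau> t) (F y \<sigma> t)
                \<le> dist (F x \<tau> s) (F y \<sigma> s) + \<omega> (dist x y + \<bar>\<tau> - \<sigma>\<bar>) * \<bar>\<xi> t - \<xi> s\<bar>)"
  shows "\<exists>\<Delta>>0. a + \<Delta> \<le> b \<and> (\<exists>u. is_solution \<Omega> F {a..a + \<Delta>} u \<and> u a = x0)"
proof -
  obtain h \<zeta> where h: "strict_mono_on {a..b} h" and \<zeta>: "modulus_function \<zeta>"
    and var: "\<And>x \<tau> t s. x \<in> \<Omega> \<Longrightarrow> \<tau> \<in> {a..b} \<Longrightarrow> t \<in> {a..b} \<Longrightarrow> s \<in> {a..b} \<Longrightarrow>
      dist (F x \<tau> t) (F x \<tau> s) \<le> \<zeta> \<bar>h t - h s\<bar>"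
    using assms(9) by blast
  obtain U where U: "U \<subseteq> \<Omega>" "L \<in> interior U"
    and solv: "\<And>\<tau>. \<tau> \<in> {a<..b} \<Longrightarrow>
      \<exists>\<mu>>0. \<forall>x\<in>U. \<forall>t\<in>{\<tau> - \<mu><..<\<tau>} \<inter> {a..b}. \<exists>y\<in>\<Omega>. F y \<tau> t = x"
    using assms(10) by blast
  obtain \<xi> \<omega> where \<xi>: "strict_mono_on {a..b} \<xi>" and \<omega>: "modulus_function \<omega>"
    and compar: "\<And>\<tau> \<sigma> t s x y. \<tau> \<in> {a..b} \<Longrightarrow> \<sigma> \<in> {a..b} \<Longrightarrow> t \<in> {a..b} \<Longrightarrow> s \<in> {a..b} \<Longrightarrow>
      x \<in> \<Omega> \<Longrightarrow> y \<in> \<Omega> \<Longrightarrow>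
      dist (F x \<tau> t) (F y \<sigma> t)
        \<le> dist (F x \<tau> s) (F y \<sigma> s) + \<omega> (dist x y + \<bar>\<tau> - \<sigma>\<bar>) * \<bar>\<xi> t - \<xi> s\<bar>"
    using assms(11) by blast
  define g where "g = (\<lambda>t. h t + \<xi> t)"
  have le: "h s \<le> h t \<and> \<xi> s \<le> \<xi> t" if "s \<in> {a..b}" "t \<in> {a..b}" "s \<le> t" for s t
    using that mono_onD[OF strict_mono_on_imp_mono_on[OF h]]
      mono_onD[OF strict_mono_on_imp_mono_on[OF \<xi>]] by blast
  \<comment> \<open>The increments of \<open>h\<close> and \<open>\<xi>\<close> have the same sign,
    so their sum dominates each of them in absolute value.\<close>
  have incr: "\<bar>h t - h s\<bar> \<le> \<bar>g t - g s\<bar>" "\<bar>\<xi> t - \<xi> s\<bar> \<le> \<bar>g t - g s\<bar>"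
    if "s \<in> {a..b}" "t \<in> {a..b}" for s t
    using le[OF that] le[OF that(2,1)] by (cases "s \<le> t"; auto simp: g_def abs_le_iff)+
  interpret gode \<Omega> F a b g \<zeta> \<omega>
  proof
    show "mono_on {a..b} g"
      using le by (auto simp: mono_on_def g_def intro: add_mono)
    show "dist (F x \<tau> t) (F x \<tau> s) \<le> \<zeta> \<bar>g t - g s\<bar>"
      if "x \<in> \<Omega>" "\<tau> \<in> {a..b}" "t \<in> {a..b}" "s \<in> {a..b}" for x \<tau> t s
      using var[OF that] modulus_mono[OF \<zeta> abs_ge_zero incr(1)[OF that(4,3)]] by linarith
    show "dist (F x \<tau> t) (F y \<sigma> t)
        \<le> dist (F x \<tau> s) (F y \<sigma> s) + \<omega> (dist x y + \<bar>\<tau> - \<sigma>\<bar>) * \<bar>g t - g s\<bar>"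
      if "\<tau> \<in> {a..b}" "\<sigma> \<in> {a..b}" "t \<in> {a..b}" "s \<in> {a..b}" "x \<in> \<Omega>" "y \<in> \<Omega>" for \<tau> \<sigma> t s x y
    proof -
      have "\<omega> (dist x y + \<bar>\<tau> - \<sigma>\<bar>) * \<bar>\<xi> t - \<xi> s\<bar> \<le> \<omega> (dist x y + \<bar>\<tau> - \<sigma>\<bar>) * \<bar>g t - g s\<bar>"
        using incr(2)[OF that(4,3)] by (intro mult_left_mono modulus_nonneg[OF \<omega>]) auto
      with compar[OF that] show ?thesis
        by linarith
    qed
  qed (use assms(4,8) \<zeta> \<omega> in auto)
  obtain r where r: "r > 0" "cball L r \<subseteq> interior U" "compact (cball L r)"
    using locally_compact_compact_cball[OF assms(1) open_interior U(2)] by blast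
  have r_sub: "cball L r \<subseteq> U"
    using r(2) interior_subset by blast
  \<comment> \<open>With \<open>b - a\<close> rather than the final interval length inside,
    \<open>M\<close> depends on \<open>r\<close> only and is fixed before \<open>c\<close> is chosen
    small.\<close>
  define M where "M = \<omega> (2 * r + dist x0 L + (b - a))"
  have "0 < 2 * r + dist x0 L + (b - a)"
    using r(1) \<open>a < b\<close> by (intro add_pos_pos add_pos_nonneg) auto
  then have M: "M > 0"
    using \<omega> unfolding M_def modulus_function_def by blast
  have r3: "0 < r / 3"
    using r(1) by simp
  have "\<forall>\<^sub>F c in at_right a. \<forall>t. a < t \<longrightarrow> t \<le> c \<longrightarrow> dist (F x0 a t) L \<le> r / 3"
  proof -
    have "\<forall>\<^sub>F t in at_right a. dist (F x0 a t) L < r / 3"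
      using assms(6) r3 by (rule tendstoD)
    then obtain d where d: "d > a" "\<And>t. a < t \<Longrightarrow> t < d \<Longrightarrow> dist (F x0 a t) L < r / 3"
      using eventually_at_right_field by metis
    show ?thesis
      using eventually_at_right_real[OF d(1)]
    proof eventually_elim
      case (elim c)
      then show ?case
        using d(2) by (auto intro: less_imp_le)
    qed
  qed
  moreover have "\<forall>\<^sub>F c in at_right a. c \<in> {a<..<b}"
    using \<open>a < b\<close> by (rule eventually_at_right_real)
  ultimately have "\<forall>\<^sub>F c in at_right a. c \<in> {a<..<b} \<and>
    (\<forall>t. a < t \<longrightarrow> t \<le> c \<longrightarrow> dist (F x0 a t) L \<le> r / 3) \<and>
    (\<forall>s t. a < s \<longrightarrow> s \<le> t \<longrightarrow> t \<le> c \<longrightarrow> M * (g t - g s) \<le> r / 3) \<and>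
    (\<forall>s t. a < s \<longrightarrow> s \<le> t \<longrightarrow> t \<le> c \<longrightarrow> \<zeta> (g t - g s) \<le> r / 3)"
    using eventually_increments_small[OF g_mono \<zeta> \<open>a < b\<close> r3]
      eventually_increments_small[OF g_mono modulus_function_scaled[OF M] \<open>a < b\<close> r3]
    by eventually_elim blast
  from eventually_happens'[OF trivial_limit_at_right_real this]
  obtain c where c: "c \<in> {a<..<b}"
    and near: "\<And>t. a < t \<Longrightarrow> t \<le> c \<Longrightarrow> dist (F x0 a t) L \<le> r / 3"
    and small: "\<And>s t. a < s \<Longrightarrow> s \<le> t \<Longrightarrow> t \<le> c \<Longrightarrow> M * (g t - g s) \<le> r / 3"
      "\<And>s t. a < s \<Longrightarrow> s \<le> t \<Longrightarrow> t \<le> c \<Longrightarrow> \<zeta> (g t - g s) \<le> r / 3"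
    by blast
  have "\<exists>\<mu>>0. \<forall>x\<in>cball L r. \<forall>t\<in>{\<tau> - \<mu><..<\<tau>} \<inter> {a..b}. \<exists>y\<in>\<Omega>. F y \<tau> t = x"
    if "\<tau> \<in> {a<..c}" for \<tau>
  proof -
    have "\<tau> \<in> {a<..b}"
      using that c by auto
    from solv[OF this] show ?thesis
      using r_sub by (meson subsetD)
  qed
  then have "\<exists>u. is_solution \<Omega> F {a..c} u \<and> u a = x0"
    using c r_sub U(1) near small
    by (intro local_solution[OF \<open>x0 \<in> \<Omega>\<close> _ _ r(1) _ r(3) _ _ M_def]) auto
  then show ?thesis
    using c by (intro exI[of _ "c - a"]) auto
qed

end
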